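(* If $G$ and $H$ are two groups that are exterior isoclinic, then $M(G)\cong M(H)$.
   Context: Notation: ${}^g h=ghg^{-1}$ and $[g,h]=ghg^{-1}h^{-1}$. The nonabelian tensor square $G\otimes G$ (Brown–Loday) is the group generated by symbols $g\otimes h$ ($g,h\in G$) subject to $gg_1\otimes h=({}^g g_1\otimes {}^g h)(g\otimes h)$ and $g\otimes hh_1=(g\otimes h)({}^h g\otimes {}^h h_1)$ for all $g,g_1,h,h_1\in G$. The exterior square $G\wedge G$ is the quotient of $G\otimes G$ by the normal subgroup generated by all $g\otimes g$; the image of $g\otimes h$ is $g\wedge h$. The Schur multiplier $M(G)$ is the kernel of the homomorphism $G\wedge G\to G$, $g\wedge h\mapsto [g,h]$ (it is isomorphic to $H_2(G,\mathbb Z)$). The exterior center is $Z^{\wedge}(G)=\{g\in G: g\wedge h=1 \text{ in } G\wedge G\ \forall h\in G\}$, a normal (central) subgroup of $G$. Groups $G$ and $H$ are exterior isoclinic if there exist isomorphisms $\alpha:G/Z^{\wedge}(G)\to H/Z^{\wedge}(H)$ and $\beta:[G,G]\to[H,H]$ such that whenever $\alpha(g_1Z^{\wedge}(G))=h_1Z^{\wedge}(H)$ and $\alpha(g_2Z^{\wedge}(G))=h_2Z^{\wedge}(H)$, one has $\beta([g_1,g_2])=[h_1,h_2]$. *)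

theory Defs
  imports "HOL-Algebra.Generated_Groups"
begin

section \<open>Groups given by generators and relators\<close>

text \<open>
  A word is a list of signed generators; \<open>(True, x)\<close> stands for \<open>x\<close> and \<open>(False, x)\<close> for its
  formal inverse. Relations are pairs \<open>(u, v)\<close> of words, read \<open>u = v\<close>. The presented group
  consists of the words over the generators modulo the least congruence that
  contains the relations and makes \<open>(True, x)\<close> and \<open>(False, x)\<close> mutually inverse.
\<close>

type_synonym 'x word = "(bool \<times> 'x) list"

definition words :: "'x set \<Rightarrow> 'x word set" where
  "words X = lists (UNIV \<times> X)"

inductive_set presented_rel :: "'x set \<Rightarrow> ('x word \<times> 'x word) set \<Rightarrow> ('x word \<times> 'x word) set"
  for X :: "'x set" and R :: "('x word \<times> 'x word) set" where
  relation: "(u, v) \<in> R \<Longrightarrow> u \<in> words X \<Longrightarrow> v \<in> words X \<Longrightarrow> (u, v) \<in> presented_rel X R"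
| cancel: "x \<in> X \<Longrightarrow> ([(b, x), (\<not> b, x)], []) \<in> presented_rel X R"
| refl: "u \<in> words X \<Longrightarrow> (u, u) \<in> presented_rel X R"
| sym: "(u, v) \<in> presented_rel X R \<Longrightarrow> (v, u) \<in> presented_rel X R"
| trans: "(u, v) \<in> presented_rel X R \<Longrightarrow> (v, w) \<in> presented_rel X R \<Longrightarrow> (u, w) \<in> presented_rel X R"
| cong: "(u, v) \<in> presented_rel X R \<Longrightarrow> (u', v') \<in> presented_rel X R
         \<Longrightarrow> (u @ u', v @ v') \<in> presented_rel X R"

definition presented_group :: "'x set \<Rightarrow> ('x word \<times> 'x word) set \<Rightarrow> 'x word set monoid" where
  "presented_group X R =
     \<lparr> carrier = words X // presented_rel X R,
       mult = (\<lambda>A B. \<Union>a\<in>A. \<Union>b\<in>B. presented_rel X R `` {a @ b}),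
       one = presented_rel X R `` {[]} \<rparr>"

fun word_eval :: "('b, 'm) monoid_scheme \<Rightarrow> ('x \<Rightarrow> 'b) \<Rightarrow> 'x word \<Rightarrow> 'b" where
  "word_eval H f [] = \<one>\<^bsub>H\<^esub>"
| "word_eval H f ((b, x) # w) = (if b then f x else inv\<^bsub>H\<^esub> (f x)) \<otimes>\<^bsub>H\<^esub> word_eval H f w"

lemma words_simps [simp]:
  "[] \<in> words X" "(p # w \<in> words X) = (snd p \<in> X \<and> w \<in> words X)"
  "(u @ v \<in> words X) = (u \<in> words X \<and> v \<in> words X)"
  by (auto simp: words_def mem_Times_iff)

lemma presented_rel_words:
  "(u, v) \<in> presented_rel X R \<Longrightarrow> u \<in> words X \<and> v \<in> words X"
  by (induction rule: presented_rel.induct) auto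

lemma equiv_presented_rel: "equiv (words X) (presented_rel X R)"
  by (auto intro!: equivI refl_onI symI transI
      intro: presented_rel.intros dest: presented_rel_words)

lemma presented_group_mult:
  assumes "u \<in> words X" "v \<in> words X"
  shows "presented_rel X R `` {u} \<otimes>\<^bsub>presented_group X R\<^esub> presented_rel X R `` {v}
         = presented_rel X R `` {u @ v}"
proof -
  have "congruent2 (presented_rel X R) (presented_rel X R) (\<lambda>a b. presented_rel X R `` {a @ b})"
    by (intro congruent2I[OF equiv_presented_rel equiv_presented_rel])
       (auto intro!: equiv_class_eq[OF equiv_presented_rel] intro: presented_rel.intros)
  then show ?thesis
    using UN_equiv_class2[OF equiv_presented_rel equiv_presented_rel _ assms]
    by (simp add: presented_group_def)
qed

lemma presented_group_carrierE:
  assumes "A \<in> carrier (presented_group X R)"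
  obtains u where "u \<in> words X" "A = presented_rel X R `` {u}"
  using assms by (auto simp: presented_group_def elim: quotientE)

lemma presented_group_class_closed:
  "u \<in> words X \<Longrightarrow> presented_rel X R `` {u} \<in> carrier (presented_group X R)"
  by (simp add: presented_group_def quotientI)

lemma group_presented_group: "group (presented_group X R)"
proof (rule groupI)
  let ?P = "presented_group X R" and ?c = "\<lambda>u. presented_rel X R `` {u}"
  have one: "\<one>\<^bsub>?P\<^esub> = ?c []" by (simp add: presented_group_def)
  show "\<one>\<^bsub>?P\<^esub> \<in> carrier ?P" by (simp add: one presented_group_class_closed)
  show "A \<otimes>\<^bsub>?P\<^esub> B \<in> carrier ?P" if "A \<in> carrier ?P" "B \<in> carrier ?P" for A B
    using that by (auto elim!: presented_group_carrierE
        simp: presented_group_mult presented_group_class_closed)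
  show "A \<otimes>\<^bsub>?P\<^esub> B \<otimes>\<^bsub>?P\<^esub> C = A \<otimes>\<^bsub>?P\<^esub> (B \<otimes>\<^bsub>?P\<^esub> C)"
    if "A \<in> carrier ?P" "B \<in> carrier ?P" "C \<in> carrier ?P" for A B C
    using that by (auto elim!: presented_group_carrierE simp: presented_group_mult)
  show "\<one>\<^bsub>?P\<^esub> \<otimes>\<^bsub>?P\<^esub> A = A" if "A \<in> carrier ?P" for A
    using that by (auto elim!: presented_group_carrierE simp: presented_group_mult one)
  show "\<exists>B\<in>carrier ?P. B \<otimes>\<^bsub>?P\<^esub> A = \<one>\<^bsub>?P\<^esub>" if A: "A \<in> carrier ?P" for A
  proof -
    have ex: "\<exists>v\<in>words X. (v @ u, []) \<in> presented_rel X R" if "u \<in> words X" for u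
      using that
    proof (induction u)
      case Nil
      then show ?case by (auto intro!: bexI[of _ "[]"] presented_rel.refl)
    next
      case (Cons p u)
      obtain b x where p: "p = (b, x)" by (cases p)
      from Cons p obtain v where v: "v \<in> words X" "(v @ u, []) \<in> presented_rel X R" and x: "x \<in> X"
        and u: "u \<in> words X" by auto
      have "([(\<not> b, x), (b, x)] @ u, [] @ u) \<in> presented_rel X R"
        using presented_rel.cancel[OF x, of "\<not> b" R] u
        by (intro presented_rel.cong presented_rel.refl) auto
      then have "(v @ [(\<not> b, x), (b, x)] @ u, v @ u) \<in> presented_rel X R"
        using v by (intro presented_rel.cong presented_rel.refl) auto
      then have "((v @ [(\<not> b, x)]) @ p # u, []) \<in> presented_rel X R"
        using v(2) p by (auto intro: presented_rel.trans)
      then show ?case using v x by (intro bexI[of _ "v @ [(\<not> b, x)]"]) auto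
    qed
    obtain u where u: "u \<in> words X" "A = ?c u" using A by (rule presented_group_carrierE)
    from ex[OF u(1)] obtain v where v: "v \<in> words X" "(v @ u, []) \<in> presented_rel X R" by blast
    have "?c v \<otimes>\<^bsub>?P\<^esub> A = \<one>\<^bsub>?P\<^esub>"
      using u v by (simp add: one presented_group_mult equiv_class_eq[OF equiv_presented_rel])
    then show ?thesis using v presented_group_class_closed by blast
  qed
qed

context group
begin

lemma word_eval_closed:
  "f \<in> X \<rightarrow> carrier G \<Longrightarrow> w \<in> words X \<Longrightarrow> word_eval G f w \<in> carrier G"
  by (induction w) (auto simp: Pi_iff)

lemma word_eval_append:
  "f \<in> X \<rightarrow> carrier G \<Longrightarrow> u \<in> words X \<Longrightarrow> v \<in> words X
   \<Longrightarrow> word_eval G f (u @ v) = word_eval G f u \<otimes> word_eval G f v"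
proof (induction u)
  case (Cons p u)
  obtain b x where "p = (b, x)" by (cases p)
  with Cons show ?case
    by (auto simp: m_assoc Pi_iff word_eval_closed[of f X])
qed (simp add: word_eval_closed)

lemma word_eval_presented_rel:
  assumes f: "f \<in> X \<rightarrow> carrier G"
    and R: "\<And>u v. (u, v) \<in> R \<Longrightarrow> u \<in> words X \<Longrightarrow> v \<in> words X \<Longrightarrow> word_eval G f u = word_eval G f v"
    and uv: "(u, v) \<in> presented_rel X R"
  shows "word_eval G f u = word_eval G f v"
  using uv
proof (induction rule: presented_rel.induct)
  case (cancel x b)
  then have "f x \<in> carrier G" using f by auto
  then show ?case by (cases b) auto
next
  case (cong u v u' v')
  then show ?case using presented_rel_words word_eval_append[OF f] by metis
qed (use R in auto)

lemma presented_group_lift: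
  assumes f: "f \<in> X \<rightarrow> carrier G"
    and R: "\<And>u v. (u, v) \<in> R \<Longrightarrow> u \<in> words X \<Longrightarrow> v \<in> words X \<Longrightarrow> word_eval G f u = word_eval G f v"
  shows "(\<lambda>A. the_elem (word_eval G f ` A)) \<in> hom (presented_group X R) G"
    and "\<And>u. u \<in> words X \<Longrightarrow>
           the_elem (word_eval G f ` (presented_rel X R `` {u})) = word_eval G f u"
proof -
  show val: "the_elem (word_eval G f ` (presented_rel X R `` {u})) = word_eval G f u"
    if "u \<in> words X" for u
  proof -
    have "word_eval G f v = word_eval G f u" if "v \<in> presented_rel X R `` {u}" for v
      using word_eval_presented_rel[OF f R, of R u v] that by simp
    moreover have "u \<in> presented_rel X R `` {u}"
      using presented_rel.refl[OF that] by simp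
    ultimately have "word_eval G f ` (presented_rel X R `` {u}) = {word_eval G f u}"
      by blast
    then show ?thesis by simp
  qed
  show "(\<lambda>A. the_elem (word_eval G f ` A)) \<in> hom (presented_group X R) G"
  proof (rule homI)
    fix A B
    assume "A \<in> carrier (presented_group X R)" "B \<in> carrier (presented_group X R)"
    then obtain u v where "u \<in> words X" "A = presented_rel X R `` {u}"
      "v \<in> words X" "B = presented_rel X R `` {v}"
      by (meson presented_group_carrierE)
    then show "the_elem (word_eval G f ` (A \<otimes>\<^bsub>presented_group X R\<^esub> B))
        = the_elem (word_eval G f ` A) \<otimes> the_elem (word_eval G f ` B)"
      by (simp add: presented_group_mult val word_eval_append[OF f])
  next
    fix A
    assume "A \<in> carrier (presented_group X R)"
    then show "the_elem (word_eval G f ` A) \<in> carrier G"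
      by (metis presented_group_carrierE val word_eval_closed[OF f])
  qed
qed

end


section \<open>Normal closure\<close>

definition normal_closure :: "('a, 'm) monoid_scheme \<Rightarrow> 'a set \<Rightarrow> 'a set" where
  "normal_closure G S = \<Inter> {N. N \<lhd> G \<and> S \<subseteq> N}"

lemma (in group) normal_closure_normal:
  assumes "S \<subseteq> carrier G"
  shows "normal_closure G S \<lhd> G"
proof -
  have c: "carrier G \<lhd> G" by (rule normal_invI[OF subgroup_self]) auto
  show ?thesis
  proof (rule normal_invI)
    show "subgroup (normal_closure G S) G"
      unfolding normal_closure_def using c assms normal_imp_subgroup
      by (intro subgroups_Inter) auto
    show "x \<otimes> h \<otimes> inv x \<in> normal_closure G S" if "x \<in> carrier G" "h \<in> normal_closure G S" for x h
      using that by (auto simp: normal_closure_def intro: normal.inv_op_closed2)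
  qed
qed


section \<open>Nonabelian tensor square and exterior square\<close>

definition conjugate :: "('a, 'm) monoid_scheme \<Rightarrow> 'a \<Rightarrow> 'a \<Rightarrow> 'a" where
  "conjugate G g h = g \<otimes>\<^bsub>G\<^esub> h \<otimes>\<^bsub>G\<^esub> inv\<^bsub>G\<^esub> g"

definition commutator :: "('a, 'm) monoid_scheme \<Rightarrow> 'a \<Rightarrow> 'a \<Rightarrow> 'a" where
  "commutator G g h = g \<otimes>\<^bsub>G\<^esub> h \<otimes>\<^bsub>G\<^esub> inv\<^bsub>G\<^esub> g \<otimes>\<^bsub>G\<^esub> inv\<^bsub>G\<^esub> h"

definition tensor_gens :: "('a, 'm) monoid_scheme \<Rightarrow> ('a \<times> 'a) set" where
  "tensor_gens G = carrier G \<times> carrier G"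

definition tensor_relations :: "('a, 'm) monoid_scheme \<Rightarrow> (('a \<times> 'a) word \<times> ('a \<times> 'a) word) set" where
  "tensor_relations G =
     {([(True, (g \<otimes>\<^bsub>G\<^esub> g1, h))],
       [(True, (conjugate G g g1, conjugate G g h)), (True, (g, h))]) | g g1 h.
        g \<in> carrier G \<and> g1 \<in> carrier G \<and> h \<in> carrier G} \<union>
     {([(True, (g, h \<otimes>\<^bsub>G\<^esub> h1))],
       [(True, (g, h)), (True, (conjugate G h g, conjugate G h h1))]) | g h h1.
        g \<in> carrier G \<and> h \<in> carrier G \<and> h1 \<in> carrier G}"

definition tensor_square :: "('a, 'm) monoid_scheme \<Rightarrow> ('a \<times> 'a) word set monoid" where
  "tensor_square G = presented_group (tensor_gens G) (tensor_relations G)"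

definition tensor :: "('a, 'm) monoid_scheme \<Rightarrow> 'a \<Rightarrow> 'a \<Rightarrow> ('a \<times> 'a) word set" where
  "tensor G g h = presented_rel (tensor_gens G) (tensor_relations G) `` {[(True, (g, h))]}"

definition tensor_diagonal :: "('a, 'm) monoid_scheme \<Rightarrow> ('a \<times> 'a) word set set" where
  "tensor_diagonal G = normal_closure (tensor_square G) {tensor G g g | g. g \<in> carrier G}"

definition exterior_square :: "('a, 'm) monoid_scheme \<Rightarrow> ('a \<times> 'a) word set set monoid" where
  "exterior_square G = tensor_square G Mod tensor_diagonal G"

definition wedge :: "('a, 'm) monoid_scheme \<Rightarrow> 'a \<Rightarrow> 'a \<Rightarrow> ('a \<times> 'a) word set set" where
  "wedge G g h = tensor_diagonal G #>\<^bsub>tensor_square G\<^esub> tensor G g h"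

text \<open>
  The homomorphisms \<open>G \<otimes> G \<rightarrow> G\<close> and \<open>G \<and> G \<rightarrow> G\<close> sending the generator given by \<open>g\<close>, \<open>h\<close> to
  \<open>[g, h]\<close>: the map on words is constant on congruence classes, and the map on the tensor square
  is constant on cosets of the diagonal. This is proved in \<open>exterior_commutator_hom\<close> and
  \<open>exterior_commutator_wedge\<close>; \<open>exterior_commutator_unique\<close> shows there is no other such homomorphism.
\<close>

definition tensor_commutator :: "('a, 'm) monoid_scheme \<Rightarrow> ('a \<times> 'a) word set \<Rightarrow> 'a" where
  "tensor_commutator G A = the_elem (word_eval G (\<lambda>(g, h). commutator G g h) ` A)"

definition exterior_commutator :: "('a, 'm) monoid_scheme \<Rightarrow> ('a \<times> 'a) word set set \<Rightarrow> 'a" where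
  "exterior_commutator G C = the_elem (tensor_commutator G ` C)"

definition schur_multiplier :: "('a, 'm) monoid_scheme \<Rightarrow> ('a \<times> 'a) word set set monoid" where
  "schur_multiplier G =
     (exterior_square G)\<lparr>carrier := kernel (exterior_square G) G (exterior_commutator G)\<rparr>"

definition exterior_center :: "('a, 'm) monoid_scheme \<Rightarrow> 'a set" where
  "exterior_center G = {g \<in> carrier G. \<forall>h \<in> carrier G. wedge G g h = \<one>\<^bsub>exterior_square G\<^esub>}"


section \<open>Exterior isoclinism\<close>

text \<open>
  Cosets are written as right cosets, as in the library's factor groups; since the exterior center
  is normal (\<open>exterior_center_normal\<close>), these are also the left cosets. The subgroup \<open>[G, G]\<close> is
  \<open>derived G (carrier G)\<close>.
\<close>

definition exterior_isoclinic :: "('a, 'm) monoid_scheme \<Rightarrow> ('b, 'n) monoid_scheme \<Rightarrow> bool" where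
  "exterior_isoclinic G H \<longleftrightarrow>
     (\<exists>\<alpha> \<beta>. \<alpha> \<in> iso (G Mod exterior_center G) (H Mod exterior_center H) \<and>
       \<beta> \<in> iso (G\<lparr>carrier := derived G (carrier G)\<rparr>) (H\<lparr>carrier := derived H (carrier H)\<rparr>) \<and>
       (\<forall>g1\<in>carrier G. \<forall>g2\<in>carrier G. \<forall>h1\<in>carrier H. \<forall>h2\<in>carrier H.
          \<alpha> (exterior_center G #>\<^bsub>G\<^esub> g1) = exterior_center H #>\<^bsub>H\<^esub> h1 \<longrightarrow>
          \<alpha> (exterior_center G #>\<^bsub>G\<^esub> g2) = exterior_center H #>\<^bsub>H\<^esub> h2 \<longrightarrow>
          \<beta> (commutator G g1 g2) = commutator H h1 h2))"


section \<open>Well-definedness of the constructions\<close>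

context group
begin

lemma inv_cancel:
  assumes "x \<in> carrier G" "y \<in> carrier G"
  shows "inv x \<otimes> (x \<otimes> y) = y" "x \<otimes> (inv x \<otimes> y) = y"
  using assms by (simp_all flip: m_assoc)

lemma conjugate_closed [simp]:
  "g \<in> carrier G \<Longrightarrow> h \<in> carrier G \<Longrightarrow> conjugate G g h \<in> carrier G"
  by (simp add: conjugate_def)

lemma commutator_closed [simp]:
  "g \<in> carrier G \<Longrightarrow> h \<in> carrier G \<Longrightarrow> commutator G g h \<in> carrier G"
  by (simp add: commutator_def)

lemma conjugate_mult:
  "g \<in> carrier G \<Longrightarrow> h \<in> carrier G \<Longrightarrow> k \<in> carrier G
   \<Longrightarrow> conjugate G g (h \<otimes> k) = conjugate G g h \<otimes> conjugate G g k"
  by (simp add: conjugate_def m_assoc inv_cancel)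

lemma conjugate_conjugate:
  "g \<in> carrier G \<Longrightarrow> h \<in> carrier G \<Longrightarrow> k \<in> carrier G
   \<Longrightarrow> conjugate G g (conjugate G h k) = conjugate G (conjugate G g h) (conjugate G g k)"
  by (simp add: conjugate_def m_assoc inv_mult_group inv_cancel)

lemma group_tensor_square: "group (tensor_square G)"
  by (simp add: tensor_square_def group_presented_group)

lemma tensor_closed: "g \<in> carrier G \<Longrightarrow> h \<in> carrier G \<Longrightarrow> tensor G g h \<in> carrier (tensor_square G)"
  by (simp add: tensor_def tensor_square_def tensor_gens_def presented_group_class_closed)

lemma tensor_mult_left:
  assumes "g \<in> carrier G" "g1 \<in> carrier G" "h \<in> carrier G"
  shows "tensor G (g \<otimes> g1) h
         = tensor G (conjugate G g g1) (conjugate G g h) \<otimes>\<^bsub>tensor_square G\<^esub> tensor G g h"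
proof -
  have "([(True, (g \<otimes> g1, h))], [(True, (conjugate G g g1, conjugate G g h)), (True, (g, h))])
        \<in> presented_rel (tensor_gens G) (tensor_relations G)"
    by (rule presented_rel.relation) (use assms in \<open>auto simp: tensor_relations_def tensor_gens_def\<close>)
  then show ?thesis using assms
    by (simp add: tensor_def tensor_square_def presented_group_mult tensor_gens_def
        equiv_class_eq[OF equiv_presented_rel])
qed

lemma tensor_mult_right:
  assumes "g \<in> carrier G" "h \<in> carrier G" "h1 \<in> carrier G"
  shows "tensor G g (h \<otimes> h1)
         = tensor G g h \<otimes>\<^bsub>tensor_square G\<^esub> tensor G (conjugate G h g) (conjugate G h h1)"
proof -
  have "([(True, (g, h \<otimes> h1))], [(True, (g, h)), (True, (conjugate G h g, conjugate G h h1))])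
        \<in> presented_rel (tensor_gens G) (tensor_relations G)"
    by (rule presented_rel.relation) (use assms in \<open>auto simp: tensor_relations_def tensor_gens_def\<close>)
  then show ?thesis using assms
    by (simp add: tensor_def tensor_square_def presented_group_mult tensor_gens_def
        equiv_class_eq[OF equiv_presented_rel])
qed

lemma tensor_diagonal_normal: "tensor_diagonal G \<lhd> tensor_square G"
  unfolding tensor_diagonal_def
  by (rule group.normal_closure_normal[OF group_tensor_square]) (auto intro: tensor_closed)

lemma group_exterior_square: "group (exterior_square G)"
  unfolding exterior_square_def by (rule normal.factorgroup_is_group[OF tensor_diagonal_normal])

lemma tensor_lift:
  fixes K (structure)
  assumes K: "group K"
    and closed: "\<And>g h. g \<in> carrier G \<Longrightarrow> h \<in> carrier G \<Longrightarrow> f g h \<in> carrier K"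
    and left: "\<And>g g1 h. g \<in> carrier G \<Longrightarrow> g1 \<in> carrier G \<Longrightarrow> h \<in> carrier G \<Longrightarrow>
      f (g \<otimes>\<^bsub>G\<^esub> g1) h = f (conjugate G g g1) (conjugate G g h) \<otimes>\<^bsub>K\<^esub> f g h"
    and right: "\<And>g h h1. g \<in> carrier G \<Longrightarrow> h \<in> carrier G \<Longrightarrow> h1 \<in> carrier G \<Longrightarrow>
      f g (h \<otimes>\<^bsub>G\<^esub> h1) = f g h \<otimes>\<^bsub>K\<^esub> f (conjugate G h g) (conjugate G h h1)"
  shows "(\<lambda>A. the_elem (word_eval K (\<lambda>(g, h). f g h) ` A)) \<in> hom (tensor_square G) K"
    and "\<And>g h. g \<in> carrier G \<Longrightarrow> h \<in> carrier G \<Longrightarrow>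
           the_elem (word_eval K (\<lambda>(g, h). f g h) ` tensor G g h) = f g h"
proof -
  interpret K: group K by (rule K)
  have 1: "(\<lambda>(g, h). f g h) \<in> tensor_gens G \<rightarrow> carrier K"
    using closed by (auto simp: tensor_gens_def)
  have 2: "word_eval K (\<lambda>(g, h). f g h) u = word_eval K (\<lambda>(g, h). f g h) v"
    if "(u, v) \<in> tensor_relations G" for u v
    using that by (auto simp: tensor_relations_def left right closed)
  show "(\<lambda>A. the_elem (word_eval K (\<lambda>(g, h). f g h) ` A)) \<in> hom (tensor_square G) K"
    unfolding tensor_square_def by (rule K.presented_group_lift(1)[OF 1 2])
  show "the_elem (word_eval K (\<lambda>(g, h). f g h) ` tensor G g h) = f g h"
    if "g \<in> carrier G" "h \<in> carrier G" for g h
    unfolding tensor_def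
    by (subst K.presented_group_lift(2)[OF 1 2]) (use that closed in \<open>auto simp: tensor_gens_def\<close>)
qed

lemma commutator_mult_left:
  assumes "g \<in> carrier G" "g1 \<in> carrier G" "h \<in> carrier G"
  shows "commutator G (g \<otimes> g1) h = commutator G (conjugate G g g1) (conjugate G g h) \<otimes> commutator G g h"
  using assms
  by (simp add: commutator_def conjugate_def m_assoc inv_mult_group inv_cancel)

lemma commutator_mult_right:
  assumes "g \<in> carrier G" "h \<in> carrier G" "h1 \<in> carrier G"
  shows "commutator G g (h \<otimes> h1) = commutator G g h \<otimes> commutator G (conjugate G h g) (conjugate G h h1)"
  using assms
  by (simp add: commutator_def conjugate_def m_assoc inv_mult_group inv_cancel)

lemma tensor_commutator_hom: "tensor_commutator G \<in> hom (tensor_square G) G"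
  unfolding tensor_commutator_def [abs_def]
  by (rule tensor_lift(1)[OF is_group]) (auto simp: commutator_mult_left commutator_mult_right)

lemma tensor_commutator_tensor:
  "g \<in> carrier G \<Longrightarrow> h \<in> carrier G \<Longrightarrow> tensor_commutator G (tensor G g h) = commutator G g h"
  unfolding tensor_commutator_def
  by (rule tensor_lift(2)[OF is_group]) (auto simp: commutator_mult_left commutator_mult_right)

lemma exterior_lift:
  assumes K: "group K" and f: "f \<in> hom (tensor_square G) K"
    and diag: "\<And>g. g \<in> carrier G \<Longrightarrow> f (tensor G g g) = \<one>\<^bsub>K\<^esub>"
  shows "(\<lambda>C. the_elem (f ` C)) \<in> hom (exterior_square G) K"
    and "\<And>g h. g \<in> carrier G \<Longrightarrow> h \<in> carrier G \<Longrightarrow> the_elem (f ` wedge G g h) = f (tensor G g h)"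
proof -
  let ?T = "tensor_square G" and ?D = "tensor_diagonal G"
  interpret T: group ?T by (rule group_tensor_square)
  interpret K: group K by (rule K)
  interpret f: group_hom ?T K f by unfold_locales (rule f)
  interpret D: normal ?D ?T by (rule tensor_diagonal_normal)
  have ker: "?D \<subseteq> kernel ?T K f"
    using f.normal_kernel diag
    by (auto simp: tensor_diagonal_def normal_closure_def kernel_def tensor_closed)
  have val: "the_elem (f ` (?D #>\<^bsub>?T\<^esub> x)) = f x" if x: "x \<in> carrier ?T" for x
  proof -
    have "f (d \<otimes>\<^bsub>?T\<^esub> x) = f x" if "d \<in> ?D" for d
      using ker that x by (auto simp: kernel_def)
    then have "f ` (?D #>\<^bsub>?T\<^esub> x) \<subseteq> {f x}"
      by (auto simp: r_coset_def)
    moreover have "f x \<in> f ` (?D #>\<^bsub>?T\<^esub> x)"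
      by (rule imageI) (rule T.rcos_self[OF x D.subgroup_axioms])
    ultimately have "f ` (?D #>\<^bsub>?T\<^esub> x) = {f x}"
      by blast
    then show ?thesis by simp
  qed
  show "(\<lambda>C. the_elem (f ` C)) \<in> hom (exterior_square G) K"
    by (auto intro!: homI simp: exterior_square_def FactGroup_def RCOSETS_def D.rcos_sum val)
  show "the_elem (f ` wedge G g h) = f (tensor G g h)" if "g \<in> carrier G" "h \<in> carrier G" for g h
    using that by (simp add: wedge_def val tensor_closed)
qed

theorem exterior_commutator_hom: "exterior_commutator G \<in> hom (exterior_square G) G"
  unfolding exterior_commutator_def [abs_def]
  by (rule exterior_lift(1)[OF is_group tensor_commutator_hom])
     (simp add: tensor_commutator_tensor, simp add: commutator_def m_assoc inv_cancel)

theorem exterior_commutator_wedge: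
  assumes "g \<in> carrier G" "h \<in> carrier G"
  shows "exterior_commutator G (wedge G g h) = commutator G g h"
  unfolding exterior_commutator_def using assms
  by (subst exterior_lift(2)[OF is_group tensor_commutator_hom])
     (simp_all add: tensor_commutator_tensor, simp add: commutator_def m_assoc inv_cancel)

lemma coset_hom_exterior:
  "(\<lambda>x. tensor_diagonal G #>\<^bsub>tensor_square G\<^esub> x) \<in> hom (tensor_square G) (exterior_square G)"
  unfolding exterior_square_def by (rule normal.r_coset_hom_Mod[OF tensor_diagonal_normal])

lemma exterior_hom_unique:
  assumes K: "group K" and p: "p \<in> hom (exterior_square G) K" and q: "q \<in> hom (exterior_square G) K"
    and eq: "\<And>g h. g \<in> carrier G \<Longrightarrow> h \<in> carrier G \<Longrightarrow> p (wedge G g h) = q (wedge G g h)"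
    and C: "C \<in> carrier (exterior_square G)"
  shows "p C = q C"
proof -
  let ?T = "tensor_square G" and ?D = "tensor_diagonal G"
  let ?c = "\<lambda>u. presented_rel (tensor_gens G) (tensor_relations G) `` {u}"
  define P Q where "P = (\<lambda>x. p (?D #>\<^bsub>?T\<^esub> x))" and "Q = (\<lambda>x. q (?D #>\<^bsub>?T\<^esub> x))"
  interpret T: group ?T by (rule group_tensor_square)
  interpret K: group K by (rule K)
  interpret P: group_hom ?T K P
    using Group.hom_compose[OF coset_hom_exterior p] by unfold_locales (simp add: P_def o_def)
  interpret Q: group_hom ?T K Q
    using Group.hom_compose[OF coset_hom_exterior q] by unfold_locales (simp add: Q_def o_def)
  have c: "?c u \<in> carrier ?T" if "u \<in> words (tensor_gens G)" for u
    using that by (simp add: tensor_square_def presented_group_class_closed)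
  have m: "?c (u @ v) = ?c u \<otimes>\<^bsub>?T\<^esub> ?c v"
    if "u \<in> words (tensor_gens G)" "v \<in> words (tensor_gens G)" for u v
    using that by (simp add: tensor_square_def presented_group_mult)
  have one: "?c [] = \<one>\<^bsub>?T\<^esub>" by (simp add: tensor_square_def presented_group_def)
  have "P (?c u) = Q (?c u)" if "u \<in> words (tensor_gens G)" for u
    using that
  proof (induction u)
    case Nil
    then show ?case by (simp add: one)
  next
    case (Cons s u)
    obtain b g h where s: "s = (b, (g, h))" by (cases s) auto
    from Cons s have gh: "(g, h) \<in> tensor_gens G" and u: "u \<in> words (tensor_gens G)" by auto
    have PQ: "P (?c [(True, (g, h))]) = Q (?c [(True, (g, h))])"
      using eq gh by (simp add: P_def Q_def wedge_def tensor_def tensor_gens_def)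
    have "?c [(False, (g, h))] \<otimes>\<^bsub>?T\<^esub> ?c [(True, (g, h))] = ?c ([(False, (g, h))] @ [(True, (g, h))])"
      by (rule m[symmetric]) (use gh in auto)
    also have "\<dots> = \<one>\<^bsub>?T\<^esub>"
      using presented_rel.cancel[OF gh, of False "tensor_relations G"]
      by (simp add: equiv_class_eq[OF equiv_presented_rel] flip: one)
    finally have "?c [(False, (g, h))] = inv\<^bsub>?T\<^esub> ?c [(True, (g, h))]"
      using gh c by (intro T.inv_equality[symmetric]) auto
    then have "P (?c [s]) = Q (?c [s])"
      using PQ s gh c by (cases b) auto
    then show ?case
      using m[of "[s]" u] c[of "[s]"] c[of u] gh u s Cons.IH by simp
  qed
  then have "P x = Q x" if "x \<in> carrier ?T" for x
    using that presented_group_carrierE unfolding tensor_square_def by metis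
  then show ?thesis
    using C by (auto simp: P_def Q_def exterior_square_def FactGroup_def RCOSETS_def)
qed

theorem exterior_commutator_unique:
  assumes "f \<in> hom (exterior_square G) G"
    and "\<And>g h. g \<in> carrier G \<Longrightarrow> h \<in> carrier G \<Longrightarrow> f (wedge G g h) = commutator G g h"
    and "C \<in> carrier (exterior_square G)"
  shows "f C = exterior_commutator G C"
  by (rule exterior_hom_unique[OF is_group assms(1) exterior_commutator_hom _ assms(3)])
     (simp add: assms(2) exterior_commutator_wedge)

theorem group_schur_multiplier: "group (schur_multiplier G)"
proof -
  interpret E: group "exterior_square G" by (rule group_exterior_square)
  interpret group_hom "exterior_square G" G "exterior_commutator G"
    by unfold_locales (rule exterior_commutator_hom)
  show ?thesis
    unfolding schur_multiplier_def by (rule E.subgroup_imp_group[OF subgroup_kernel])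
qed

lemma wedge_closed:
  "g \<in> carrier G \<Longrightarrow> h \<in> carrier G \<Longrightarrow> wedge G g h \<in> carrier (exterior_square G)"
  using hom_in_carrier[OF coset_hom_exterior tensor_closed] by (simp add: wedge_def)

lemma wedge_mult_left:
  assumes "g \<in> carrier G" "g1 \<in> carrier G" "h \<in> carrier G"
  shows "wedge G (g \<otimes> g1) h
         = wedge G (conjugate G g g1) (conjugate G g h) \<otimes>\<^bsub>exterior_square G\<^esub> wedge G g h"
  using assms hom_mult[OF coset_hom_exterior]
  by (simp add: wedge_def tensor_mult_left tensor_closed)

lemma wedge_mult_right:
  assumes "g \<in> carrier G" "h \<in> carrier G" "h1 \<in> carrier G"
  shows "wedge G g (h \<otimes> h1)
         = wedge G g h \<otimes>\<^bsub>exterior_square G\<^esub> wedge G (conjugate G h g) (conjugate G h h1)"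
  using assms hom_mult[OF coset_hom_exterior]
  by (simp add: wedge_def tensor_mult_right tensor_closed)

lemma wedge_self:
  assumes "g \<in> carrier G"
  shows "wedge G g g = \<one>\<^bsub>exterior_square G\<^esub>"
proof -
  interpret D: normal "tensor_diagonal G" "tensor_square G" by (rule tensor_diagonal_normal)
  have "tensor G g g \<in> tensor_diagonal G"
    using assms by (auto simp: tensor_diagonal_def normal_closure_def)
  then show ?thesis
    by (simp add: wedge_def exterior_square_def D.rcos_const)
qed

lemma wedge_conjugate_eq_one:
  assumes "k \<in> carrier G" "g \<in> carrier G" "h \<in> carrier G"
    and "wedge G g h = \<one>\<^bsub>exterior_square G\<^esub>"
  shows "wedge G (conjugate G k g) (conjugate G k h) = \<one>\<^bsub>exterior_square G\<^esub>"
proof -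
  let ?E = "exterior_square G"
  let ?f = "\<lambda>g h. wedge G (conjugate G k g) (conjugate G k h)"
  have E: "group ?E" by (rule group_exterior_square)
  note lift = tensor_lift[where f = ?f and K = ?E, OF E]
  have 1: "?f x y \<in> carrier ?E" if "x \<in> carrier G" "y \<in> carrier G" for x y
    using that assms(1) by (simp add: wedge_closed)
  have 2: "?f (x \<otimes> x1) y = ?f (conjugate G x x1) (conjugate G x y) \<otimes>\<^bsub>?E\<^esub> ?f x y"
    if "x \<in> carrier G" "x1 \<in> carrier G" "y \<in> carrier G" for x x1 y
    using that assms(1) by (simp add: conjugate_mult wedge_mult_left conjugate_conjugate[of k x])
  have 3: "?f x (y \<otimes> y1) = ?f x y \<otimes>\<^bsub>?E\<^esub> ?f (conjugate G y x) (conjugate G y y1)"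
    if "x \<in> carrier G" "y \<in> carrier G" "y1 \<in> carrier G" for x y y1
    using that assms(1) by (simp add: conjugate_mult wedge_mult_right conjugate_conjugate[of k y])
  define F where "F = (\<lambda>A. the_elem (word_eval ?E (\<lambda>(g, h). ?f g h) ` A))"
  have F: "F \<in> hom (tensor_square G) ?E"
    unfolding F_def by (rule lift(1)) (simp_all only: 1 2 3)
  have Fv: "F (tensor G x y) = ?f x y" if "x \<in> carrier G" "y \<in> carrier G" for x y
    unfolding F_def by (rule lift(2)) (simp_all only: 1 2 3 that)
  have diag: "F (tensor G x x) = \<one>\<^bsub>?E\<^esub>" if "x \<in> carrier G" for x
    using that assms(1) by (simp add: Fv wedge_self)
  have "the_elem (F ` \<one>\<^bsub>?E\<^esub>) = \<one>\<^bsub>?E\<^esub>"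
    by (rule hom_one[OF exterior_lift(1)[OF E F diag] E E])
  then show ?thesis
    using exterior_lift(2)[OF E F diag assms(2,3)] assms Fv by simp
qed

theorem exterior_center_normal: "exterior_center G \<lhd> G"
proof -
  let ?Z = "exterior_center G" and ?E = "exterior_square G"
  interpret E: group ?E by (rule group_exterior_square)
  have conj_Z: "wedge G (conjugate G k g) h = \<one>\<^bsub>?E\<^esub>"
    if "g \<in> ?Z" "k \<in> carrier G" "h \<in> carrier G" for k g h
  proof -
    have "conjugate G k (conjugate G (inv k) h) = h"
      using that by (simp add: conjugate_def m_assoc inv_cancel)
    then show ?thesis
      using wedge_conjugate_eq_one[of k g "conjugate G (inv k) h"] that
      by (simp add: exterior_center_def)
  qed
  have one: "wedge G \<one> h = \<one>\<^bsub>?E\<^esub>" if h: "h \<in> carrier G" for h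
  proof -
    have "wedge G \<one> h = wedge G \<one> h \<otimes>\<^bsub>?E\<^esub> wedge G \<one> h"
      using wedge_mult_left[of \<one> \<one> h] h by (simp add: conjugate_def)
    then show ?thesis using wedge_closed[of \<one> h] h by (metis E.r_cancel_one' one_closed)
  qed
  show ?thesis
  proof (rule normal_invI)
    show "subgroup ?Z G"
    proof (rule subgroupI)
      show "?Z \<subseteq> carrier G" by (auto simp: exterior_center_def)
      show "?Z \<noteq> {}" using one by (auto simp: exterior_center_def)
      show "inv g \<in> ?Z" if g: "g \<in> ?Z" for g
      proof -
        have "wedge G (inv g) h = \<one>\<^bsub>?E\<^esub>" if h: "h \<in> carrier G" for h
        proof -
          have gc: "g \<in> carrier G" using g by (simp add: exterior_center_def)
          have "\<one>\<^bsub>?E\<^esub> = wedge G (inv g \<otimes> g) h" using gc h one by simp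
          also have "\<dots> = wedge G (inv g) h"
            using gc h by (subst wedge_mult_left) (simp_all add: conj_Z[OF g] wedge_closed)
          finally show ?thesis by simp
        qed
        then show ?thesis using g by (simp add: exterior_center_def)
      qed
      show "g \<otimes> g1 \<in> ?Z" if "g \<in> ?Z" "g1 \<in> ?Z" for g g1
        using that conj_Z[OF that(2)] by (auto simp: exterior_center_def wedge_mult_left)
    qed
    show "x \<otimes> g \<otimes> inv x \<in> ?Z" if "x \<in> carrier G" "g \<in> ?Z" for x g
      using that conj_Z[OF that(2,1)] by (auto simp: exterior_center_def conjugate_def)
  qed
qed

end

end

theory Submission
  imports Defs
begin

text \<open>
  The exterior square only sees a group modulo its exterior center: if \<open>z\<close> is an exterior central
  element, then \<open>z g \<and> h = g \<and> h\<close>, and by antisymmetry of the wedge the same holds in the second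
  argument (\<open>wedge_exterior_center_cong\<close>). Hence every homomorphism \<open>\<alpha>\<close> between the quotients by
  the exterior centers induces a homomorphism of the exterior squares that sends \<open>g\<^sub>1 \<and> g\<^sub>2\<close> to
  \<open>h\<^sub>1 \<and> h\<^sub>2\<close> whenever \<open>\<alpha>\<close> sends the coset of each \<open>g\<^sub>i\<close> to that of \<open>h\<^sub>i\<close>
  (\<open>exterior_square_induced_hom\<close>). A homomorphism on the exterior square is determined by its values
  on wedges, so if \<open>\<alpha>\<close> is an isomorphism, the maps induced by \<open>\<alpha>\<close> and by its inverse are inverse
  to each other (\<open>exterior_square_induced_inverse\<close>).

  It remains to see that this isomorphism \<open>F\<close> matches the two Schur multipliers. The compatibility
  of \<open>\<alpha>\<close> and \<open>\<beta>\<close> says that \<open>\<kappa>\<^sub>H \<circ> F = \<beta> \<circ> \<kappa>\<^sub>G\<close> on wedges, where \<open>\<kappa>\<close> is the commutator homomorphism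
  on the exterior square; by the same uniqueness the equation holds everywhere. Since \<open>\<beta>\<close> is
  injective, an element is in the kernel of \<open>\<kappa>\<^sub>G\<close> if and only if \<open>F\<close> sends it into the kernel of \<open>\<kappa>\<^sub>H\<close>.
\<close>

section \<open>Homomorphisms on the exterior square\<close>

context group
begin

lemma exterior_square_lift:
  assumes K: "group K"
    and closed: "\<And>g h. g \<in> carrier G \<Longrightarrow> h \<in> carrier G \<Longrightarrow> f g h \<in> carrier K"
    and left: "\<And>g g1 h. g \<in> carrier G \<Longrightarrow> g1 \<in> carrier G \<Longrightarrow> h \<in> carrier G \<Longrightarrow>
      f (g \<otimes> g1) h = f (conjugate G g g1) (conjugate G g h) \<otimes>\<^bsub>K\<^esub> f g h"
    and right: "\<And>g h h1. g \<in> carrier G \<Longrightarrow> h \<in> carrier G \<Longrightarrow> h1 \<in> carrier G \<Longrightarrow>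
      f g (h \<otimes> h1) = f g h \<otimes>\<^bsub>K\<^esub> f (conjugate G h g) (conjugate G h h1)"
    and diag: "\<And>g. g \<in> carrier G \<Longrightarrow> f g g = \<one>\<^bsub>K\<^esub>"
  obtains F where "F \<in> hom (exterior_square G) K"
    and "\<And>g h. g \<in> carrier G \<Longrightarrow> h \<in> carrier G \<Longrightarrow> F (wedge G g h) = f g h"
proof -
  define T where "T = (\<lambda>A. the_elem (word_eval K (\<lambda>(g, h). f g h) ` A))"
  have T: "T \<in> hom (tensor_square G) K"
    unfolding T_def by (rule tensor_lift(1)[OF K]) (simp_all only: closed left right)
  have Tv: "T (tensor G g h) = f g h" if "g \<in> carrier G" "h \<in> carrier G" for g h
    unfolding T_def by (rule tensor_lift(2)[OF K]) (simp_all only: closed left right that)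
  have Td: "T (tensor G g g) = \<one>\<^bsub>K\<^esub>" if "g \<in> carrier G" for g
    using that by (simp add: Tv diag)
  show thesis
    by (rule that[of "\<lambda>C. the_elem (T ` C)"])
      (simp_all add: exterior_lift[OF K T Td] Tv)
qed

text \<open>
  An isomorphism \<open>\<beta>\<close> of derived subgroups can only be composed with the commutator homomorphism
  once the latter is known to take values in the derived subgroup. It does, since the universal
  property yields a homomorphism into that subgroup with the same values on wedges.
\<close>

lemma exterior_commutator_hom_derived:
  "exterior_commutator G \<in> hom (exterior_square G) (G\<lparr>carrier := derived G (carrier G)\<rparr>)"
proof -
  let ?D = "derived G (carrier G)" and ?E = "exterior_square G"
  have sub: "subgroup ?D G" by (rule derived_is_subgroup) simp
  have mem: "commutator G g h \<in> ?D" if "g \<in> carrier G" "h \<in> carrier G" for g h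
    using that unfolding derived_def commutator_def by (blast intro: generate.incl)
  obtain F where F: "F \<in> hom ?E (G\<lparr>carrier := ?D\<rparr>)"
    and Fv: "\<And>g h. g \<in> carrier G \<Longrightarrow> h \<in> carrier G \<Longrightarrow> F (wedge G g h) = commutator G g h"
    by (rule exterior_square_lift[OF subgroup_imp_group[OF sub], of "commutator G"])
      (simp_all add: mem commutator_mult_left commutator_mult_right,
       simp_all add: commutator_def m_assoc inv_cancel)
  have F': "F \<in> hom ?E G"
    using F subgroup.subset[OF sub] by (auto simp: hom_def)
  have "F C = exterior_commutator G C" if "C \<in> carrier ?E" for C
    by (rule exterior_commutator_unique[OF F' Fv that])
  then have "exterior_commutator G C \<in> ?D" if "C \<in> carrier ?E" for C
    using F that hom_in_carrier by fastforce
  then show ?thesis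
    using exterior_commutator_hom by (auto simp: hom_def)
qed

section \<open>The wedge modulo the exterior center\<close>

text \<open>
  Expanding \<open>gk \<and> gk = 1\<close> by both product rules, two of the four factors vanish, which leaves
  \<open>(\<^sup>gk \<and> g)(g \<and> \<^sup>gk) = 1\<close>; every \<open>h\<close> has the form \<open>\<^sup>gk\<close>.
\<close>

lemma wedge_antisym:
  assumes g: "g \<in> carrier G" and h: "h \<in> carrier G"
  shows "wedge G g h = inv\<^bsub>exterior_square G\<^esub> wedge G h g"
proof -
  let ?E = "exterior_square G"
  interpret E: group ?E by (rule group_exterior_square)
  define k where "k = inv g \<otimes> h \<otimes> g"
  have k: "k \<in> carrier G" and gk: "g \<otimes> k = h \<otimes> g" and conj: "conjugate G g k = h"
    and conj_self: "conjugate G g g = g"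
    using g h by (simp_all add: k_def conjugate_def m_assoc inv_cancel)
  have self: "conjugate G h h = h"
    using h by (simp add: conjugate_def m_assoc)
  have right: "wedge G g (g \<otimes> k) = wedge G g h"
    using g h k by (simp add: wedge_mult_right conj conj_self wedge_self wedge_closed)
  have left: "wedge G h (g \<otimes> h) = wedge G h g"
    using g h by (simp add: wedge_mult_right wedge_self wedge_closed)
  have "\<one>\<^bsub>?E\<^esub> = wedge G (g \<otimes> k) (g \<otimes> k)"
    using g k by (simp add: wedge_self)
  also have "\<dots> = wedge G h (g \<otimes> h) \<otimes>\<^bsub>?E\<^esub> wedge G g (g \<otimes> k)"
    using g k by (simp add: wedge_mult_left conjugate_mult conj conj_self)
  finally have "wedge G h g \<otimes>\<^bsub>?E\<^esub> wedge G g h = \<one>\<^bsub>?E\<^esub>"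
    by (simp only: left right)
  then show ?thesis
    using g h by (metis E.inv_equality E.inv_inv wedge_closed)
qed

lemma wedge_exterior_center_mult_left:
  assumes z: "z \<in> exterior_center G" and g: "g \<in> carrier G" and h: "h \<in> carrier G"
  shows "wedge G (z \<otimes> g) h = wedge G g h"
proof -
  have zc: "z \<in> carrier G" using z by (simp add: exterior_center_def)
  \<comment> \<open>With \<open>g\<close> on the left, the product rule leaves the second factor \<open>g \<and> h\<close> unconjugated.\<close>
  have "z \<otimes> g = g \<otimes> (inv g \<otimes> z \<otimes> g)" "conjugate G g (inv g \<otimes> z \<otimes> g) = z"
    using zc g by (simp_all add: conjugate_def m_assoc inv_cancel)
  moreover have "wedge G z (conjugate G g h) = \<one>\<^bsub>exterior_square G\<^esub>"
    using z g h by (simp add: exterior_center_def)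
  ultimately show ?thesis
    using zc g h monoid.l_one[OF group.is_monoid[OF group_exterior_square]]
    by (simp add: wedge_mult_left wedge_closed)
qed

lemma wedge_exterior_center_cong:
  assumes "g \<in> carrier G" "g' \<in> carrier G" "h \<in> carrier G" "h' \<in> carrier G"
    and "exterior_center G #> g = exterior_center G #> g'"
    and "exterior_center G #> h = exterior_center G #> h'"
  shows "wedge G g h = wedge G g' h'"
proof -
  have left: "wedge G x y = wedge G x' y"
    if "x \<in> carrier G" "x' \<in> carrier G" "y \<in> carrier G"
      "exterior_center G #> x = exterior_center G #> x'" for x x' y
  proof -
    have "x \<in> exterior_center G #> x'"
      using that(1,4) rcos_self normal_imp_subgroup[OF exterior_center_normal] by blast
    then show ?thesis
      using that by (auto simp: r_coset_def wedge_exterior_center_mult_left)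
  qed
  have "wedge G g h = wedge G g' h"
    by (rule left) (use assms in auto)
  also have "\<dots> = inv\<^bsub>exterior_square G\<^esub> wedge G h g'"
    using assms by (intro wedge_antisym)
  also have "wedge G h g' = wedge G h' g'"
    by (rule left) (use assms in auto)
  also have "inv\<^bsub>exterior_square G\<^esub> wedge G h' g' = wedge G g' h'"
    using assms by (intro wedge_antisym[symmetric])
  finally show ?thesis .
qed

section \<open>Induced homomorphisms of exterior squares\<close>

text \<open>
  Choosing for each \<open>g\<close> a representative of the coset that \<open>\<alpha>\<close> assigns to the coset of \<open>g\<close> gives a
  map that is multiplicative only up to the exterior center of \<open>H\<close>, but wedges in \<open>H\<close> do not
  notice the difference, so the defining relations of the exterior square hold for its values.
\<close>

lemma exterior_square_induced_hom:
  assumes H: "group H"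
    and \<alpha>: "\<alpha> \<in> hom (G Mod exterior_center G) (H Mod exterior_center H)"
  obtains F where "F \<in> hom (exterior_square G) (exterior_square H)"
    and "\<And>g1 g2 h1 h2. g1 \<in> carrier G \<Longrightarrow> g2 \<in> carrier G \<Longrightarrow> h1 \<in> carrier H \<Longrightarrow> h2 \<in> carrier H \<Longrightarrow>
      \<alpha> (exterior_center G #> g1) = exterior_center H #>\<^bsub>H\<^esub> h1 \<Longrightarrow>
      \<alpha> (exterior_center G #> g2) = exterior_center H #>\<^bsub>H\<^esub> h2 \<Longrightarrow>
      F (wedge G g1 g2) = wedge H h1 h2"
proof -
  interpret H: group H by (rule H)
  interpret ZG: normal "exterior_center G" G by (rule exterior_center_normal)
  interpret ZH: normal "exterior_center H" H by (rule H.exterior_center_normal)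
  interpret Q: group_hom "G Mod exterior_center G" "H Mod exterior_center H" \<alpha>
    by (intro group_hom.intro group_hom_axioms.intro ZG.factorgroup_is_group
        ZH.factorgroup_is_group \<alpha>)
  define c where "c = (\<lambda>g. exterior_center G #> g)"
  define d where "d = (\<lambda>h. exterior_center H #>\<^bsub>H\<^esub> h)"
  interpret c: group_hom G "G Mod exterior_center G" c
    unfolding c_def by (intro group_hom.intro group_hom_axioms.intro is_group
        ZG.factorgroup_is_group ZG.r_coset_hom_Mod)
  interpret d: group_hom H "H Mod exterior_center H" d
    unfolding d_def by (intro group_hom.intro group_hom_axioms.intro H
        ZH.factorgroup_is_group ZH.r_coset_hom_Mod)
  define r where "r = (\<lambda>g. SOME h. h \<in> carrier H \<and> d h = \<alpha> (c g))"
  have ex: "\<exists>h. h \<in> carrier H \<and> d h = \<alpha> (c g)" if "g \<in> carrier G" for g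
  proof -
    have "\<alpha> (c g) \<in> carrier (H Mod exterior_center H)" using that by simp
    then show ?thesis by (auto simp: d_def FactGroup_def RCOSETS_def)
  qed
  have r: "r g \<in> carrier H" "d (r g) = \<alpha> (c g)" if "g \<in> carrier G" for g
    using someI_ex[OF ex[OF that]] by (simp_all add: r_def)
  have d_mult: "d (r (g \<otimes> g')) = d (r g \<otimes>\<^bsub>H\<^esub> r g')"
    if "g \<in> carrier G" "g' \<in> carrier G" for g g'
    using that by (simp add: r del: mult_FactGroup)
  have d_conj: "d (r (conjugate G g g')) = d (conjugate H (r g) (r g'))"
    if "g \<in> carrier G" "g' \<in> carrier G" for g g'
    using that by (simp add: conjugate_def r del: mult_FactGroup)
  have cong: "wedge H x y = wedge H x' y'"
    if "x \<in> carrier H" "x' \<in> carrier H" "y \<in> carrier H" "y' \<in> carrier H" "d x = d x'" "d y = d y'"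
    for x x' y y'
    using H.wedge_exterior_center_cong[OF that(1-4)] that(5,6) by (simp add: d_def)
  obtain F where F: "F \<in> hom (exterior_square G) (exterior_square H)"
    and Fv: "\<And>g g'. g \<in> carrier G \<Longrightarrow> g' \<in> carrier G \<Longrightarrow> F (wedge G g g') = wedge H (r g) (r g')"
  proof (rule exterior_square_lift[OF H.group_exterior_square, of "\<lambda>g g'. wedge H (r g) (r g')"])
    fix g g1 h assume *: "g \<in> carrier G" "g1 \<in> carrier G" "h \<in> carrier G"
    have "wedge H (r (g \<otimes> g1)) (r h) = wedge H (r g \<otimes>\<^bsub>H\<^esub> r g1) (r h)"
      by (rule cong) (use * d_mult r in auto)
    also have "\<dots> = wedge H (conjugate H (r g) (r g1)) (conjugate H (r g) (r h))
        \<otimes>\<^bsub>exterior_square H\<^esub> wedge H (r g) (r h)"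
      using * r by (intro H.wedge_mult_left)
    also have "wedge H (conjugate H (r g) (r g1)) (conjugate H (r g) (r h))
        = wedge H (r (conjugate G g g1)) (r (conjugate G g h))"
      by (rule cong) (use * d_conj r in auto)
    finally show "wedge H (r (g \<otimes> g1)) (r h) = wedge H (r (conjugate G g g1)) (r (conjugate G g h))
        \<otimes>\<^bsub>exterior_square H\<^esub> wedge H (r g) (r h)" .
  next
    fix g h h1 assume *: "g \<in> carrier G" "h \<in> carrier G" "h1 \<in> carrier G"
    have "wedge H (r g) (r (h \<otimes> h1)) = wedge H (r g) (r h \<otimes>\<^bsub>H\<^esub> r h1)"
      by (rule cong) (use * d_mult r in auto)
    also have "\<dots> = wedge H (r g) (r h) \<otimes>\<^bsub>exterior_square H\<^esub>
        wedge H (conjugate H (r h) (r g)) (conjugate H (r h) (r h1))"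
      using * r by (intro H.wedge_mult_right)
    also have "wedge H (conjugate H (r h) (r g)) (conjugate H (r h) (r h1))
        = wedge H (r (conjugate G h g)) (r (conjugate G h h1))"
      by (rule cong) (use * d_conj r in auto)
    finally show "wedge H (r g) (r (h \<otimes> h1)) = wedge H (r g) (r h) \<otimes>\<^bsub>exterior_square H\<^esub>
        wedge H (r (conjugate G h g)) (r (conjugate G h h1))" .
  qed (use r in \<open>auto simp: H.wedge_closed H.wedge_self\<close>)
  show thesis
  proof (rule that[OF F])
    fix g1 g2 h1 h2
    assume *: "g1 \<in> carrier G" "g2 \<in> carrier G" "h1 \<in> carrier H" "h2 \<in> carrier H"
      "\<alpha> (exterior_center G #> g1) = exterior_center H #>\<^bsub>H\<^esub> h1"
      "\<alpha> (exterior_center G #> g2) = exterior_center H #>\<^bsub>H\<^esub> h2"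
    have "wedge H (r g1) (r g2) = wedge H h1 h2"
      by (rule cong) (use * r in \<open>auto simp: c_def d_def\<close>)
    then show "F (wedge G g1 g2) = wedge H h1 h2"
      using * by (simp add: Fv)
  qed
qed

text \<open>
  One half of the bijectivity of the induced maps; applied once more with the two groups exchanged,
  it gives the other half.
\<close>

lemma exterior_square_induced_inverse:
  assumes H: "group H"
    and \<alpha>: "\<alpha> \<in> hom (G Mod exterior_center G) (H Mod exterior_center H)"
    and F: "F \<in> hom (exterior_square G) (exterior_square H)"
    and F': "F' \<in> hom (exterior_square H) (exterior_square G)"
    and Fv: "\<And>g1 g2 h1 h2. g1 \<in> carrier G \<Longrightarrow> g2 \<in> carrier G \<Longrightarrow> h1 \<in> carrier H \<Longrightarrow> h2 \<in> carrier H \<Longrightarrow>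
      \<alpha> (exterior_center G #> g1) = exterior_center H #>\<^bsub>H\<^esub> h1 \<Longrightarrow>
      \<alpha> (exterior_center G #> g2) = exterior_center H #>\<^bsub>H\<^esub> h2 \<Longrightarrow>
      F (wedge G g1 g2) = wedge H h1 h2 \<and> F' (wedge H h1 h2) = wedge G g1 g2"
    and C: "C \<in> carrier (exterior_square G)"
  shows "F' (F C) = C"
proof -
  have ex: "\<exists>h\<in>carrier H. \<alpha> (exterior_center G #> g) = exterior_center H #>\<^bsub>H\<^esub> h"
    if "g \<in> carrier G" for g
  proof -
    have "exterior_center G #> g \<in> carrier (G Mod exterior_center G)"
      using that by (auto simp: FactGroup_def RCOSETS_def)
    then have "\<alpha> (exterior_center G #> g) \<in> carrier (H Mod exterior_center H)"
      using \<alpha> hom_in_carrier by fastforce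
    then show ?thesis by (auto simp: FactGroup_def RCOSETS_def)
  qed
  have "(F' \<circ> F) C = id C"
  proof (rule exterior_hom_unique[OF group_exterior_square _ _ _ C])
    show "F' \<circ> F \<in> hom (exterior_square G) (exterior_square G)"
      by (rule Group.hom_compose[OF F F'])
    show "id \<in> hom (exterior_square G) (exterior_square G)"
      by (simp add: hom_def)
    fix g1 g2 assume g: "g1 \<in> carrier G" "g2 \<in> carrier G"
    obtain h1 where h1: "h1 \<in> carrier H" "\<alpha> (exterior_center G #> g1) = exterior_center H #>\<^bsub>H\<^esub> h1"
      using ex[OF g(1)] by blast
    obtain h2 where h2: "h2 \<in> carrier H" "\<alpha> (exterior_center G #> g2) = exterior_center H #>\<^bsub>H\<^esub> h2"
      using ex[OF g(2)] by blast
    show "(F' \<circ> F) (wedge G g1 g2) = id (wedge G g1 g2)"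
      using Fv[OF g h1(1) h2(1) h1(2) h2(2)] by simp
  qed
  then show ?thesis by simp
qed

end


section \<open>Exterior isoclinic groups\<close>

theorem corollary3p4:
  fixes G :: "('a, 'm) monoid_scheme" and H :: "('b, 'n) monoid_scheme"
  assumes "group G" and "group H"
    and "exterior_isoclinic G H"
  shows "schur_multiplier G \<cong> schur_multiplier H"
proof -
  interpret G: group G by (rule assms)
  interpret H: group H by (rule assms)
  let ?EG = "exterior_square G" and ?EH = "exterior_square H"
  let ?ZG = "exterior_center G" and ?ZH = "exterior_center H"
  let ?DG = "G\<lparr>carrier := derived G (carrier G)\<rparr>" and ?DH = "H\<lparr>carrier := derived H (carrier H)\<rparr>"
  let ?\<kappa>G = "exterior_commutator G" and ?\<kappa>H = "exterior_commutator H"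
  obtain \<alpha> \<beta> where \<alpha>: "\<alpha> \<in> iso (G Mod ?ZG) (H Mod ?ZH)" and \<beta>: "\<beta> \<in> iso ?DG ?DH"
    and compat: "\<And>g1 g2 h1 h2. g1 \<in> carrier G \<Longrightarrow> g2 \<in> carrier G \<Longrightarrow> h1 \<in> carrier H \<Longrightarrow>
      h2 \<in> carrier H \<Longrightarrow> \<alpha> (?ZG #>\<^bsub>G\<^esub> g1) = ?ZH #>\<^bsub>H\<^esub> h1 \<Longrightarrow> \<alpha> (?ZG #>\<^bsub>G\<^esub> g2) = ?ZH #>\<^bsub>H\<^esub> h2 \<Longrightarrow>
      \<beta> (commutator G g1 g2) = commutator H h1 h2"
    using assms(3) unfolding exterior_isoclinic_def by blast
  define \<alpha>' where "\<alpha>' = inv_into (carrier (G Mod ?ZG)) \<alpha>"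
  have \<alpha>': "\<alpha>' \<in> iso (H Mod ?ZH) (G Mod ?ZG)"
    unfolding \<alpha>'_def using G.exterior_center_normal \<alpha>
    by (intro group.iso_set_sym normal.factorgroup_is_group)
  have hom: "\<alpha> \<in> hom (G Mod ?ZG) (H Mod ?ZH)" "\<alpha>' \<in> hom (H Mod ?ZH) (G Mod ?ZG)"
    using \<alpha> \<alpha>' by (simp_all add: iso_def)
  have coset_G: "?ZG #>\<^bsub>G\<^esub> g \<in> carrier (G Mod ?ZG)" if "g \<in> carrier G" for g
    using that by (auto simp: FactGroup_def RCOSETS_def)
  have coset_H: "?ZH #>\<^bsub>H\<^esub> h \<in> carrier (H Mod ?ZH)" if "h \<in> carrier H" for h
    using that by (auto simp: FactGroup_def RCOSETS_def)
  have bij: "bij_betw \<alpha> (carrier (G Mod ?ZG)) (carrier (H Mod ?ZH))"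
    using \<alpha> by (simp add: iso_def)
  have flip: "\<alpha>' (?ZH #>\<^bsub>H\<^esub> h) = ?ZG #>\<^bsub>G\<^esub> g \<longleftrightarrow> \<alpha> (?ZG #>\<^bsub>G\<^esub> g) = ?ZH #>\<^bsub>H\<^esub> h"
    if "g \<in> carrier G" "h \<in> carrier H" for g h
    unfolding \<alpha>'_def using bij_betw_inv_into_left[OF bij coset_G[OF that(1)]]
      bij_betw_inv_into_right[OF bij coset_H[OF that(2)]] by auto
  obtain F where F: "F \<in> hom ?EG ?EH"
    and Fv: "\<And>g1 g2 h1 h2. g1 \<in> carrier G \<Longrightarrow> g2 \<in> carrier G \<Longrightarrow> h1 \<in> carrier H \<Longrightarrow>
      h2 \<in> carrier H \<Longrightarrow> \<alpha> (?ZG #>\<^bsub>G\<^esub> g1) = ?ZH #>\<^bsub>H\<^esub> h1 \<Longrightarrow> \<alpha> (?ZG #>\<^bsub>G\<^esub> g2) = ?ZH #>\<^bsub>H\<^esub> h2 \<Longrightarrow>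
      F (wedge G g1 g2) = wedge H h1 h2"
    using G.exterior_square_induced_hom[OF assms(2) hom(1)] by blast
  obtain F' where F': "F' \<in> hom ?EH ?EG"
    and F'v: "\<And>h1 h2 g1 g2. h1 \<in> carrier H \<Longrightarrow> h2 \<in> carrier H \<Longrightarrow> g1 \<in> carrier G \<Longrightarrow>
      g2 \<in> carrier G \<Longrightarrow> \<alpha>' (?ZH #>\<^bsub>H\<^esub> h1) = ?ZG #>\<^bsub>G\<^esub> g1 \<Longrightarrow> \<alpha>' (?ZH #>\<^bsub>H\<^esub> h2) = ?ZG #>\<^bsub>G\<^esub> g2 \<Longrightarrow>
      F' (wedge H h1 h2) = wedge G g1 g2"
    using H.exterior_square_induced_hom[OF assms(1) hom(2)] by blast
  have F'F: "F' (F C) = C" if "C \<in> carrier ?EG" for C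
    by (rule G.exterior_square_induced_inverse[OF assms(2) hom(1) F F' _ that])
      (simp add: Fv F'v flip)
  have FF': "F (F' C) = C" if "C \<in> carrier ?EH" for C
    by (rule H.exterior_square_induced_inverse[OF assms(1) hom(2) F' F _ that])
      (simp add: Fv F'v flip)
  have \<beta>_hom: "\<beta> \<in> hom ?DG ?DH" and \<beta>_inj: "inj_on \<beta> (carrier ?DG)"
    using \<beta> by (auto simp: iso_def bij_betw_def)
  have DG: "group ?DG" and DH: "group ?DH"
    using G.subgroup_imp_group[OF G.derived_is_subgroup] H.subgroup_imp_group[OF H.derived_is_subgroup]
    by auto
  have natural: "?\<kappa>H (F C) = \<beta> (?\<kappa>G C)" if C: "C \<in> carrier ?EG" for C
  proof -
    have "(?\<kappa>H \<circ> F) C = (\<beta> \<circ> ?\<kappa>G) C"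
    proof (rule G.exterior_hom_unique[OF DH _ _ _ C])
      show "?\<kappa>H \<circ> F \<in> hom ?EG ?DH"
        by (rule Group.hom_compose[OF F H.exterior_commutator_hom_derived])
      show "\<beta> \<circ> ?\<kappa>G \<in> hom ?EG ?DH"
        by (rule Group.hom_compose[OF G.exterior_commutator_hom_derived \<beta>_hom])
    next
      fix g1 g2 assume g: "g1 \<in> carrier G" "g2 \<in> carrier G"
      have "\<exists>h\<in>carrier H. \<alpha> (?ZG #>\<^bsub>G\<^esub> g) = ?ZH #>\<^bsub>H\<^esub> h" if "g \<in> carrier G" for g
        using hom_in_carrier[OF hom(1) coset_G[OF that]] by (auto simp: FactGroup_def RCOSETS_def)
      then obtain h1 h2 where "h1 \<in> carrier H" "\<alpha> (?ZG #>\<^bsub>G\<^esub> g1) = ?ZH #>\<^bsub>H\<^esub> h1"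
        "h2 \<in> carrier H" "\<alpha> (?ZG #>\<^bsub>G\<^esub> g2) = ?ZH #>\<^bsub>H\<^esub> h2"
        using g by meson
      then show "(?\<kappa>H \<circ> F) (wedge G g1 g2) = (\<beta> \<circ> ?\<kappa>G) (wedge G g1 g2)"
        using g by (simp add: Fv compat G.exterior_commutator_wedge H.exterior_commutator_wedge)
    qed
    then show ?thesis by simp
  qed
  have kernel_iff: "?\<kappa>H (F C) = \<one>\<^bsub>H\<^esub> \<longleftrightarrow> ?\<kappa>G C = \<one>\<^bsub>G\<^esub>" if C: "C \<in> carrier ?EG" for C
  proof -
    have "\<beta> \<one>\<^bsub>G\<^esub> = \<one>\<^bsub>H\<^esub>" using hom_one[OF \<beta>_hom DG DH] by simp
    moreover have "?\<kappa>G C \<in> carrier ?DG"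
      by (rule hom_in_carrier[OF G.exterior_commutator_hom_derived C])
    moreover have "\<one>\<^bsub>G\<^esub> \<in> carrier ?DG"
      using group.is_monoid[OF DG] monoid.one_closed by fastforce
    ultimately show ?thesis
      using inj_on_eq_iff[OF \<beta>_inj] natural[OF C] by metis
  qed
  have "F \<in> iso (schur_multiplier G) (schur_multiplier H)"
  proof (rule isoI)
    show "F \<in> hom (schur_multiplier G) (schur_multiplier H)"
      using F by (auto simp: hom_def schur_multiplier_def kernel_def kernel_iff)
    show "bij_betw F (carrier (schur_multiplier G)) (carrier (schur_multiplier H))"
    proof (rule bij_betw_byWitness[where f' = F'])
      show "F' ` carrier (schur_multiplier H) \<subseteq> carrier (schur_multiplier G)"
        using hom_in_carrier[OF F']
        by (auto simp: schur_multiplier_def kernel_def FF' simp flip: kernel_iff)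
    qed (use hom_in_carrier[OF F] in \<open>auto simp: schur_multiplier_def kernel_def kernel_iff F'F FF'\<close>)
  qed
  then show ?thesis by (auto simp: is_iso_def)
qed

end
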